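(* Consider the following conditions, each required for all real $x>0$: (i) $\dfrac{P_{2k}(x)}{Q_{2k}(x)}<F(x)<\dfrac{P_{2k-1}(x)}{Q_{2k-1}(x)}$ for $k=1,2,\dots$; (ii) $F_n(x)>0$ for $n=1,2,\dots$; (iii) for $n=1,2,\dots$: $F_n(x)>0$ if $n$ is odd, and $F_n(x)>\dfrac{2}{n}$ if $n$ is even. Then condition (i) implies condition (ii), and conditions (ii) and (iii) are equivalent.
   Context: For real $x>0$ put $F(x)=e^{x}\int_x^\infty \frac{e^{-t}}{t}\,dt=\int_0^\infty \frac{e^{-t}}{t+x}\,dt$. For an integer $m\ge1$ let $c_m=c_m(x)$ be $x$ if $m$ is odd and $\frac{2}{m}$ if $m$ is even. The functions $F_n$ are defined inductively by $F_1(x)=\frac{1}{F(x)}$ and $F_{n+1}(x)=\frac{1}{F_n(x)-c_n(x)}$ for $n\ge1$ ($c_n$ is the main term of $F_n$ at infinity). The polynomials $P_n(x),Q_n(x)$ are defined by $P_{-1}(x)=1$, $Q_{-1}(x)=0$, $P_0(x)=0$, $Q_0(x)=1$, and, for $n\ge1$, $P_n(x)=c_nP_{n-1}(x)+P_{n-2}(x)$, $Q_n(x)=c_nQ_{n-1}(x)+Q_{n-2}(x)$. *)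

theory Defs
  imports "HOL-Analysis.Analysis" "HOL-Computational_Algebra.Polynomial"
begin

definition F :: "real \<Rightarrow> real" where
  "F x = exp x * (LBINT t:{x<..}. exp (- t) / t)"

lemma set_integrable_F:
  fixes x :: real
  assumes "x > 0"
  shows "set_integrable lborel {x<..} (\<lambda>t. exp (- t) / t)"
proof -
  have meas: "(\<lambda>t::real. exp (- t) / t) \<in> borel_measurable borel"
    by measurable
  have "(\<lambda>t::real. exp (- (1::real) * t)) integrable_on {x..}"
    using integrable_on_exp_minus_to_infinity[of 1 x] by simp
  then have "(\<lambda>t::real. exp (- t)) absolutely_integrable_on {x..}"
    by (intro nonnegative_absolutely_integrable_1) auto
  then have "set_integrable lborel {x..} (\<lambda>t::real. exp (- t))"
    unfolding set_integrable_def by (subst (asm) integrable_completion) auto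
  then have "set_integrable lborel {x<..} (\<lambda>t::real. exp (- t))"
    by (rule set_integrable_subset) auto
  then have "set_integrable lborel {x<..} (\<lambda>t::real. exp (- t) / x)"
    by simp
  then show ?thesis
  proof (rule set_integrable_bound)
    show "set_borel_measurable lborel {x<..} (\<lambda>t. exp (- t) / t)"
      unfolding set_borel_measurable_def using meas by measurable
    show "AE t in lborel. t \<in> {x<..} \<longrightarrow> norm (exp (- t) / t) \<le> norm (exp (- t) / x)"
      using assms by (intro AE_I2) (auto intro!: divide_left_mono mult_pos_pos)
  qed
qed

lemma F_alt: "F x = (LBINT t:{0<..}. exp (- t) / (t + x))"
proof -
  have "(LBINT t:{x<..}. exp (- t) / t)
      = (LBINT t. indicator {x<..} (x + 1 * t) *\<^sub>R (exp (- (x + 1 * t)) / (x + 1 * t)))"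
    unfolding set_lebesgue_integral_def
    by (subst lborel_integral_real_affine[where c = 1 and t = x]) auto
  also have "\<dots> = (LBINT t. exp (- x) * (indicator {0<..} t *\<^sub>R (exp (- t) / (t + x))))"
    by (rule Bochner_Integration.integral_cong)
       (auto simp: indicator_def exp_minus exp_add exp_diff field_simps)
  also have "\<dots> = exp (- x) * (LBINT t:{0<..}. exp (- t) / (t + x))"
    unfolding set_lebesgue_integral_def by (simp only: integral_mult_right_zero)
  finally show ?thesis
    by (simp add: F_def exp_minus)
qed

definition c :: "nat \<Rightarrow> real poly" where
  "c m = (if odd m then [:0, 1:] else [:2 / real m:])"

text \<open>Only the indices \<open>n \<ge> 1\<close> of \<open>Fn\<close> are meaningful; \<open>Fn 0\<close> is a filler value.
  Division is total with \<open>1 / 0 = 0\<close>, so if \<open>Fn n x\<close> equals \<open>poly (c n) x\<close> then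
  \<open>Fn (n + 1) x = 0\<close>, which violates both \<open>Fn (n + 1) x > 0\<close> and, for even \<open>n + 1\<close>,
  \<open>Fn (n + 1) x > 2 / (n + 1)\<close>.\<close>

fun Fn :: "nat \<Rightarrow> real \<Rightarrow> real" where
  "Fn 0 x = F x"
| "Fn (Suc 0) x = 1 / F x"
| "Fn (Suc (Suc n)) x = 1 / (Fn (Suc n) x - poly (c (Suc n)) x)"

text \<open>The indices of \<open>P\<close> and \<open>Q\<close> start at \<open>-1\<close>; the values below \<open>-1\<close> are fillers.\<close>

function P :: "int \<Rightarrow> real poly" where
  "P n = (if n \<le> - 1 then 1 else if n = 0 then 0
          else c (nat n) * P (n - 1) + P (n - 2))"
  by auto
termination by (relation "Wellfounded.measure (\<lambda>n. nat (n + 1))") auto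

function Q :: "int \<Rightarrow> real poly" where
  "Q n = (if n \<le> - 1 then 0 else if n = 0 then 1
          else c (nat n) * Q (n - 1) + Q (n - 2))"
  by auto
termination by (relation "Wellfounded.measure (\<lambda>n. nat (n + 1))") auto

declare P.simps [simp del] Q.simps [simp del]

end

(* With remainders D_n = F Q_n - P_n, which satisfy the same recurrence as P_n and Q_n, one has
   F_n = - D_(n-2) / D_(n-1). As Q_n > 0, condition (i) says exactly that D_n is positive for even
   and negative for odd n, so every F_n is positive. Conversely, F_(n+1) > 0 forces
   F_n > c_n, which turns (ii) into (iii). *)
theory Submission
  imports Defs
begin

lemma poly_c: "poly (c m) x = (if odd m then x else 2 / real m)"
  by (simp add: c_def)

lemma P_minus_1: "P (- 1) = 1" and P_0: "P 0 = 0"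
  and P_rec: "n \<ge> 1 \<Longrightarrow> P n = c (nat n) * P (n - 1) + P (n - 2)"
  by (subst P.simps, simp)+

lemma Q_minus_1: "Q (- 1) = 0" and Q_0: "Q 0 = 1"
  and Q_rec: "n \<ge> 1 \<Longrightarrow> Q n = c (nat n) * Q (n - 1) + Q (n - 2)"
  by (subst Q.simps, simp)+

lemma poly_Q_pos:
  assumes "x > 0"
  shows "poly (Q (int n)) x > 0"
proof -
  \<comment> \<open>The recurrence reaches two indices back, so the induction carries both; only
    \<open>\<ge> 0\<close> can hold at the lower one, as \<open>Q (- 1) = 0\<close>.\<close>
  have "poly (Q (int n - 1)) x \<ge> 0 \<and> poly (Q (int n)) x > 0"
  proof (induction n)
    case (Suc n)
    have "Q (int (Suc n)) = c (Suc n) * Q (int n) + Q (int n - 1)"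
      using Q_rec[of "int (Suc n)"] by (simp add: nat_add_distrib)
    moreover have "poly (c (Suc n)) x > 0"
      using assms by (simp add: poly_c)
    ultimately show ?case
      using Suc by (auto intro: add_pos_nonneg)
  qed (simp add: Q_minus_1 Q_0)
  then show ?thesis ..
qed

definition remainder :: "int \<Rightarrow> real \<Rightarrow> real" where
  "remainder n x = F x * poly (Q n) x - poly (P n) x"

lemma remainder_minus_1: "remainder (- 1) x = - 1" and remainder_0: "remainder 0 x = F x"
  by (simp_all add: remainder_def P_minus_1 P_0 Q_minus_1 Q_0)

lemma remainder_Suc:
  "remainder (int (Suc n)) x = poly (c (Suc n)) x * remainder (int n) x + remainder (int n - 1) x"
  using P_rec[of "int (Suc n)"] Q_rec[of "int (Suc n)"]
  by (simp add: remainder_def nat_add_distrib algebra_simps)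

text \<open>Subtracting \<open>c\<close> from the ratio and inverting is one step of the remainder
  recurrence. Nonvanishing is asked only below \<open>n\<close>: if
  \<open>remainder (int n) x\<close> is 0, both sides are 0 by the convention for division by
  0.\<close>

lemma Fn_eq_remainder_ratio:
  assumes "\<And>m. m < n \<Longrightarrow> remainder (int m) x \<noteq> 0"
  shows "Fn (Suc n) x = - remainder (int n - 1) x / remainder (int n) x"
  using assms
proof (induction n)
  case 0
  show ?case
    by (simp add: remainder_minus_1 remainder_0)
next
  case (Suc n)
  have nz: "remainder (int n) x \<noteq> 0"
    using Suc.prems by simp
  \<comment> \<open>Over the common denominator \<open>remainder (int n) x\<close>, the numerator is
    minus the right-hand side of \<open>remainder_Suc\<close>.\<close>
  have "Fn (Suc n) x - poly (c (Suc n)) x = - remainder (int (Suc n)) x / remainder (int n) x"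
    using nz Suc by (simp add: remainder_Suc field_simps del: of_nat_Suc)
  then show ?case
    by simp
qed

text \<open>A positive reciprocal has a positive denominator; \<open>Fn n x = poly (c n) x\<close>
  is excluded because then \<open>Fn (Suc n) x = 1 / 0 = 0\<close>.\<close>

lemma Fn_gt_c:
  assumes "n \<ge> 1" and "Fn (Suc n) x > 0"
  shows "Fn n x > poly (c n) x"
  using assms by (cases n) auto

text \<open>Multiplying the bounds by the positive \<open>Q\<close> turns them into signs of
  remainders.\<close>

lemma remainder_sign:
  assumes "x > 0"
    and bounds: "\<And>k::nat. k \<ge> 1 \<Longrightarrow>
         poly (P (2 * int k)) x / poly (Q (2 * int k)) x < F x \<and>
         F x < poly (P (2 * int k - 1)) x / poly (Q (2 * int k - 1)) x"
  shows "if even n then remainder (int n) x > 0 else remainder (int n) x < 0"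
proof (cases "even n")
  case True
  then obtain k where k: "n = 2 * k" ..
  show ?thesis
  proof (cases "k = 0")
    case True
    \<comment> \<open>The bounds start at \<open>k = 1\<close>, so index 0 is treated apart: its
      remainder is \<open>F x\<close>, positive by the lower bound for \<open>k = 1\<close>.\<close>
    have "poly (P 2) x = 1"
      using P_rec[of 2] P_rec[of 1] by (simp add: P_0 P_minus_1 poly_c)
    moreover have "0 < poly (Q 2) x"
      using poly_Q_pos[OF assms(1), of 2] by simp
    ultimately have "0 < poly (P 2) x / poly (Q 2) x"
      by simp
    also have "\<dots> < F x"
      using bounds[of 1] by simp
    finally show ?thesis
      using True k by (simp add: remainder_0)
  next
    case False
    then show ?thesis
      using bounds[of k] k poly_Q_pos[OF assms(1), of n]
      by (simp add: remainder_def divide_less_eq)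
  qed
next
  case False
  then obtain k where k: "n = 2 * k + 1" ..
  have "F x < poly (P (int n)) x / poly (Q (int n)) x"
    \<comment> \<open>The odd index \<open>2 * k + 1\<close> is \<open>2 * (k + 1) - 1\<close>,
      hence the instance \<open>Suc k\<close>.\<close>
    using bounds[of "Suc k"] k by (simp add: algebra_simps)
  then show ?thesis
    using False poly_Q_pos[OF assms(1), of n] by (simp add: remainder_def less_divide_eq)
qed

text \<open>Consecutive remainders have opposite signs, so minus their quotient is positive.\<close>

lemma Fn_pos_of_bounds:
  assumes "x > 0"
    and bounds: "\<And>k::nat. k \<ge> 1 \<Longrightarrow>
         poly (P (2 * int k)) x / poly (Q (2 * int k)) x < F x \<and>
         F x < poly (P (2 * int k - 1)) x / poly (Q (2 * int k - 1)) x"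
    and "n \<ge> 1"
  shows "Fn n x > 0"
proof -
  note sign = remainder_sign[OF assms(1,2)]
  have nz: "remainder (int m) x \<noteq> 0" for m
    using sign[of m] by (auto split: if_splits)
  obtain m where m: "n = Suc m"
    using assms(3) by (cases n) auto
  have Fn: "Fn n x = - remainder (int m - 1) x / remainder (int m) x"
    using Fn_eq_remainder_ratio[of m x] nz m by simp
  show ?thesis
  proof (cases m)
    \<comment> \<open>The numerator here has index -1, outside the range of \<open>sign\<close>; its
      value is known to be -1.\<close>
    case 0
    then show ?thesis
      using Fn sign[of 0] by (simp add: remainder_minus_1)
  next
    case (Suc l)
    then show ?thesis
      using Fn sign[of m] sign[of l]
      by (cases "even l") (simp_all add: divide_neg_neg divide_pos_pos divide_less_0_iff)
  qed
qed

theorem lemma5p1: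
  shows
    "((\<forall>x>0. \<forall>k::nat. k \<ge> 1 \<longrightarrow>
         poly (P (2 * int k)) x / poly (Q (2 * int k)) x < F x \<and>
         F x < poly (P (2 * int k - 1)) x / poly (Q (2 * int k - 1)) x)
       \<longrightarrow> (\<forall>x>0. \<forall>n\<ge>1. Fn n x > 0))
     \<and>
     ((\<forall>x>0. \<forall>n\<ge>1. Fn n x > 0)
       \<longleftrightarrow>
      (\<forall>x>0. \<forall>n\<ge>1. (odd n \<longrightarrow> Fn n x > 0) \<and> (even n \<longrightarrow> Fn n x > 2 / real n)))"
proof (intro conjI impI iffI allI)
  fix x :: real and n :: nat
  assume "\<forall>x>0. \<forall>k::nat. k \<ge> 1 \<longrightarrow>
         poly (P (2 * int k)) x / poly (Q (2 * int k)) x < F x \<and>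
         F x < poly (P (2 * int k - 1)) x / poly (Q (2 * int k - 1)) x"
    and "x > 0" and "1 \<le> n"
  then show "Fn n x > 0"
    by (intro Fn_pos_of_bounds) auto
next
  fix x :: real and n :: nat
  assume pos: "\<forall>x>0. \<forall>n\<ge>1. Fn n x > 0" and "x > 0" "1 \<le> n"
  then show "Fn n x > 0"
    by blast
next
  fix x :: real and n :: nat
  assume pos: "\<forall>x>0. \<forall>n\<ge>1. Fn n x > 0" and "x > 0" "1 \<le> n" "even n"
  \<comment> \<open>Positivity is used at index \<open>n + 1\<close>.\<close>
  then have "Fn n x > poly (c n) x"
    by (intro Fn_gt_c) auto
  then show "Fn n x > 2 / real n"
    using \<open>even n\<close> by (simp add: poly_c)
next
  fix x :: real and n :: nat
  assume "\<forall>x>0. \<forall>n\<ge>1. (odd n \<longrightarrow> Fn n x > 0) \<and> (even n \<longrightarrow> Fn n x > 2 / real n)"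
    and "x > 0" "1 \<le> n"
  then have "Fn n x > 0 \<or> Fn n x > 2 / real n"
    by blast
  moreover have "2 / real n \<ge> 0"
    by simp
  ultimately show "Fn n x > 0"
    by linarith
qed

end
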